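(* Let $\mathcal A_0$ be the space of $N$-tuples $\{(G_j,L_j)\}_{j=1}^N$ with $G_j\in SL(n,\mathbb C)$ and $L_j$ traceless diagonal matrices with distinct eigenvalues, equipped with the Poisson structure $$\{\overset1{G_j},\overset2{G_k}\}=-\overset1{G_j}\overset2{G_k}\,r(L_k)\,\delta_{jk},\qquad\{\overset1{G_j},\overset2{L_k}\}=-\overset1{G_k}\,\Omega\,\delta_{jk}$$ (brackets between entries of the $L_j$'s vanish). Let $A_j=G_jL_jG_j^{-1}$, and let $t_1,\dots,t_N\in\mathbb C$ be pairwise distinct. Then the system $$\frac{\partial G_k}{\partial t_j}=\frac{A_jG_k}{t_j-t_k}\ (j\ne k),\qquad \frac{\partial G_k}{\partial t_k}=-\sum_{j\neq k}\frac{A_jG_k}{t_j-t_k},\qquad\frac{\partial L_k}{\partial t_j}=0$$ is a multi-time Hamiltonian system with respect to this Poisson structure: it is of the form $$\frac{\partial G_k}{\partial t_j}=\{H_j,G_k\},\qquad \frac{\partial L_k}{\partial t_j}=\{H_j,L_k\},\qquad j,k=1,\dots,N,$$ with the time-dependent Hamiltonians $$H_j=\sum_{i\neq j}\frac{\mathrm{tr}\,A_iA_j}{t_j-t_i}.$$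
   Context: $\overset1M=M\otimes\mathbf 1$, $\overset2M=\mathbf 1\otimes M$, and $\{\overset1X,\overset2Y\}=\sum\{X_{ab},Y_{cd}\}E_{ab}\otimes E_{cd}$, where $E_{ab}$ is the elementary matrix with $1$ in position $(a,b)$. For $L=\mathrm{diag}(\lambda_1,\dots,\lambda_n)$, $$r(L)=\sum_{i<j}\frac{E_{ij}\otimes E_{ji}-E_{ji}\otimes E_{ij}}{\lambda_i-\lambda_j},\qquad \Omega=\sum_{i=1}^nE_{ii}\otimes E_{ii}-\frac1n\mathbf 1\otimes\mathbf 1 .$$ The bracket $\{H,G\}$ of a function with a matrix is taken entrywise. *)

theory Defs
  imports "HOL-Analysis.Analysis"
begin

definition cscale :: "complex \<Rightarrow> complex^'n^'m \<Rightarrow> complex^'n^'m" (infixr "*\<^sub>m" 75)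
  where "c *\<^sub>m M = (\<chi> i j. c * M $ i $ j)"

definition matrix_unit :: "'n \<Rightarrow> 'n \<Rightarrow> complex^'n^'n"
  where "matrix_unit a b = (\<chi> i j. if i = a \<and> j = b then 1 else 0)"

text \<open>Elements of \<open>Mat n \<otimes> Mat n\<close> are matrices indexed by pairs (Kronecker product).\<close>

definition kron :: "complex^'n^'n \<Rightarrow> complex^'n^'n \<Rightarrow> complex^('n \<times> 'n)^('n \<times> 'n)"
    (infixl "\<otimes>\<^sub>k" 76)
  where "X \<otimes>\<^sub>k Y = (\<chi> p q. X $ fst p $ fst q * Y $ snd p $ snd q)"

definition left_factor :: "complex^'n^'n \<Rightarrow> complex^('n \<times> 'n)^('n \<times> 'n)"
  where "left_factor M = M \<otimes>\<^sub>k mat 1"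

definition right_factor :: "complex^'n^'n \<Rightarrow> complex^('n \<times> 'n)^('n \<times> 'n)"
  where "right_factor M = mat 1 \<otimes>\<^sub>k M"

definition r_matrix ::
    "complex^'n::{finite,linorder}^'n::{finite,linorder} \<Rightarrow> complex^('n \<times> 'n)^('n \<times> 'n)"
  where "r_matrix L = (\<Sum>i\<in>UNIV. \<Sum>j\<in>{j. i < j}. (1 / (L $ i $ i - L $ j $ j)) *\<^sub>m
     (matrix_unit i j \<otimes>\<^sub>k matrix_unit j i - matrix_unit j i \<otimes>\<^sub>k matrix_unit i j))"

definition Omega :: "complex^('n::finite \<times> 'n)^('n \<times> 'n)"
  where "Omega = (\<Sum>i\<in>UNIV. matrix_unit i i \<otimes>\<^sub>k matrix_unit i i)
     - (1 / of_nat CARD('n)) *\<^sub>m (mat 1 \<otimes>\<^sub>k mat 1)"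

text \<open>\<open>('n, 'm) ambient\<close> is the vector space of all tuples of pairs of matrices, with
  \<open>n = CARD('n)\<close> and \<open>N = CARD('m)\<close>. The order on \<open>'n\<close>, where required, only serves the
  sum over \<open>i < j\<close> in the r-matrix.\<close>

type_synonym ('n, 'm) ambient = "((complex^'n^'n) \<times> (complex^'n^'n))^'m"

definition Gm :: "'m \<Rightarrow> ('n::finite, 'm::finite) ambient \<Rightarrow> complex^'n^'n"
  where "Gm j x = fst (x $ j)"

definition Lm :: "'m \<Rightarrow> ('n::finite, 'm::finite) ambient \<Rightarrow> complex^'n^'n"
  where "Lm j x = snd (x $ j)"

definition Am :: "'m \<Rightarrow> ('n::finite, 'm::finite) ambient \<Rightarrow> complex^'n^'n"
  where "Am j x = Gm j x ** Lm j x ** matrix_inv (Gm j x)"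

definition phase_space :: "('n::finite, 'm::finite) ambient set"
  where "phase_space = {x. \<forall>j. det (Gm j x) = 1
     \<and> (\<forall>a b. a \<noteq> b \<longrightarrow> Lm j x $ a $ b = 0)
     \<and> trace (Lm j x) = 0
     \<and> (\<forall>a b. a \<noteq> b \<longrightarrow> Lm j x $ a $ a \<noteq> Lm j x $ b $ b)}"

definition ambient_scale ::
    "complex \<Rightarrow> ('n::finite, 'm::finite) ambient \<Rightarrow> ('n, 'm) ambient"
  where "ambient_scale c x = (\<chi> j. (c *\<^sub>m Gm j x, c *\<^sub>m Lm j x))"

text \<open>Holomorphy in several variables: the real Frechet derivative exists at every point
  and is complex linear.\<close>

definition ambient_holomorphic_on ::
    "(('n::finite, 'm::finite) ambient \<Rightarrow> complex) \<Rightarrow> ('n, 'm) ambient set \<Rightarrow> bool"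
  where "ambient_holomorphic_on F U \<longleftrightarrow> (\<forall>x\<in>U. \<exists>D. (F has_derivative D) (at x)
     \<and> (\<forall>c v. D (ambient_scale c v) = c * D v))"

text \<open>The phase space is a complex submanifold of the ambient space, and a function on it is
  holomorphic iff it locally extends to a holomorphic function on the ambient
  space. Its values off the phase space are irrelevant.\<close>

definition phase_holomorphic :: "(('n::finite, 'm::finite) ambient \<Rightarrow> complex) set"
  where "phase_holomorphic = {f. \<forall>p\<in>phase_space. \<exists>U F. open U \<and> p \<in> U
     \<and> ambient_holomorphic_on F U \<and> (\<forall>x \<in> U \<inter> phase_space. F x = f x)}"

text \<open>A Poisson bracket on an algebra \<open>\<F>\<close> of complex functions on a set \<open>M\<close>. As functions
  are total in HOL, \<open>br_cong\<close> says that the bracket only depends on the restrictions to \<open>M\<close>.\<close>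

locale poisson_bracket =
  fixes M :: "'a set"
    and \<F> :: "('a \<Rightarrow> complex) set"
    and br :: "('a \<Rightarrow> complex) \<Rightarrow> ('a \<Rightarrow> complex) \<Rightarrow> 'a \<Rightarrow> complex"
  assumes br_cong: "\<lbrakk>f \<in> \<F>; f' \<in> \<F>; g \<in> \<F>; g' \<in> \<F>;
        \<And>y. y \<in> M \<Longrightarrow> f y = f' y; \<And>y. y \<in> M \<Longrightarrow> g y = g' y; x \<in> M\<rbrakk>
        \<Longrightarrow> br f g x = br f' g' x"
    and br_closed: "\<lbrakk>f \<in> \<F>; g \<in> \<F>\<rbrakk> \<Longrightarrow> br f g \<in> \<F>"
    and br_skew: "\<lbrakk>f \<in> \<F>; g \<in> \<F>; x \<in> M\<rbrakk> \<Longrightarrow> br f g x = - br g f x"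
    and br_add: "\<lbrakk>f \<in> \<F>; g \<in> \<F>; h \<in> \<F>; x \<in> M\<rbrakk>
        \<Longrightarrow> br (\<lambda>y. f y + g y) h x = br f h x + br g h x"
    and br_scale: "\<lbrakk>f \<in> \<F>; g \<in> \<F>; x \<in> M\<rbrakk> \<Longrightarrow> br (\<lambda>y. c * f y) g x = c * br f g x"
    and br_leibniz: "\<lbrakk>f \<in> \<F>; g \<in> \<F>; h \<in> \<F>; x \<in> M\<rbrakk>
        \<Longrightarrow> br (\<lambda>y. f y * g y) h x = f x * br g h x + br f h x * g x"
    and br_jacobi: "\<lbrakk>f \<in> \<F>; g \<in> \<F>; h \<in> \<F>; x \<in> M\<rbrakk>
        \<Longrightarrow> br f (br g h) x + br g (br h f) x + br h (br f g) x = 0"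

definition tensor_bracket ::
    "(('a \<Rightarrow> complex) \<Rightarrow> ('a \<Rightarrow> complex) \<Rightarrow> 'a \<Rightarrow> complex)
     \<Rightarrow> ('a \<Rightarrow> complex^'n^'n) \<Rightarrow> ('a \<Rightarrow> complex^'n^'n) \<Rightarrow> 'a
     \<Rightarrow> complex^('n::finite \<times> 'n)^('n \<times> 'n)"
  where "tensor_bracket br X Y x = (\<Sum>a\<in>UNIV. \<Sum>b\<in>UNIV. \<Sum>c\<in>UNIV. \<Sum>d\<in>UNIV.
     br (\<lambda>y. X y $ a $ b) (\<lambda>y. Y y $ c $ d) x *\<^sub>m (matrix_unit a b \<otimes>\<^sub>k matrix_unit c d))"

definition matrix_bracket ::
    "(('a \<Rightarrow> complex) \<Rightarrow> ('a \<Rightarrow> complex) \<Rightarrow> 'a \<Rightarrow> complex)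
     \<Rightarrow> ('a \<Rightarrow> complex) \<Rightarrow> ('a \<Rightarrow> complex^'n^'n) \<Rightarrow> 'a \<Rightarrow> complex^'n^'n"
  where "matrix_bracket br H X x = (\<chi> a b. br H (\<lambda>y. X y $ a $ b) x)"

definition is_phase_poisson ::
    "((('n::{finite,linorder}, 'm::finite) ambient \<Rightarrow> complex) \<Rightarrow> (('n, 'm) ambient \<Rightarrow> complex)
      \<Rightarrow> ('n, 'm) ambient \<Rightarrow> complex) \<Rightarrow> bool"
  where "is_phase_poisson br \<longleftrightarrow>
     poisson_bracket phase_space phase_holomorphic br \<and>
     (\<forall>x\<in>phase_space. \<forall>j k.
        tensor_bracket br (Gm j) (Gm k) x =
          (if j = k
           then - (left_factor (Gm j x) ** right_factor (Gm k x) ** r_matrix (Lm k x)) else 0)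
      \<and> tensor_bracket br (Gm j) (Lm k) x =
          (if j = k then - (left_factor (Gm k x) ** Omega) else 0)
      \<and> tensor_bracket br (Lm j) (Lm k) x = 0)"

definition distinct_times :: "(complex^'m) set"
  where "distinct_times = {t. \<forall>i j. i \<noteq> j \<longrightarrow> t $ i \<noteq> t $ j}"

text \<open>A multi-time system is given by its right-hand sides: \<open>V t j x\<close> is the prescribed value
  of the derivative with respect to \<open>t $ j\<close>, at time \<open>t\<close> and state \<open>x\<close>.\<close>

type_synonym ('n, 'm) multitime_field =
  "complex^'m \<Rightarrow> 'm \<Rightarrow> ('n, 'm) ambient \<Rightarrow> ('n, 'm) ambient"

definition schlesinger_field :: "('n::finite, 'm::finite) multitime_field"
  where "schlesinger_field t j x = (\<chi> k.
     (if j = k then - (\<Sum>i\<in>UNIV - {k}. (1 / (t $ i - t $ k)) *\<^sub>m (Am i x ** Gm k x))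
      else (1 / (t $ j - t $ k)) *\<^sub>m (Am j x ** Gm k x), 0))"

definition hamiltonian_field ::
    "((('n::finite, 'm::finite) ambient \<Rightarrow> complex) \<Rightarrow> (('n, 'm) ambient \<Rightarrow> complex)
       \<Rightarrow> ('n, 'm) ambient \<Rightarrow> complex)
     \<Rightarrow> (complex^'m \<Rightarrow> 'm \<Rightarrow> ('n, 'm) ambient \<Rightarrow> complex) \<Rightarrow> ('n, 'm) multitime_field"
  where "hamiltonian_field br H t j x =
     (\<chi> k. (matrix_bracket br (H t j) (Gm k) x, matrix_bracket br (H t j) (Lm k) x))"

definition schlesinger_hamiltonian ::
    "complex^'m \<Rightarrow> 'm \<Rightarrow> ('n::finite, 'm::finite) ambient \<Rightarrow> complex"
  where "schlesinger_hamiltonian t j x =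
     (\<Sum>i\<in>UNIV - {j}. trace (Am i x ** Am j x) / (t $ j - t $ i))"

definition solves_on ::
    "('n::finite, 'm::finite) multitime_field \<Rightarrow> (complex^'m) set
     \<Rightarrow> (complex^'m \<Rightarrow> ('n, 'm) ambient) \<Rightarrow> bool"
  where "solves_on V T \<gamma> \<longleftrightarrow> (\<forall>t\<in>T. \<gamma> t \<in> phase_space \<and> (\<forall>j k a b.
     ((\<lambda>s. Gm k (\<gamma> (\<chi> i. if i = j then s else t $ i)) $ a $ b)
        has_field_derivative Gm k (V t j (\<gamma> t)) $ a $ b) (at (t $ j)) \<and>
     ((\<lambda>s. Lm k (\<gamma> (\<chi> i. if i = j then s else t $ i)) $ a $ b)
        has_field_derivative Lm k (V t j (\<gamma> t)) $ a $ b) (at (t $ j))))"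

end

theory Submission
  imports Defs
begin

text \<open>
  Both systems have the same right-hand sides at every point of the phase space, and this is
  what makes their solutions agree: a solution is required to stay in the phase space, and the
  equations only involve the values of the fields along it. So everything reduces to computing
  the brackets of the Hamiltonian with the coordinates \<open>G\<^sub>k\<close> and \<open>L\<^sub>k\<close>.

  The reason for the equality of the fields is that \<open>A\<^sub>k = G\<^sub>k L\<^sub>k G\<^sub>k\<^sup>-\<^sup>1\<close> is the moment map of left
  translations of \<open>G\<^sub>k\<close>: for every constant traceless matrix \<open>M\<close> one has
  \<open>{tr (M A\<^sub>k), G\<^sub>k} = M G\<^sub>k\<close> and \<open>{tr (M A\<^sub>k), L\<^sub>k} = 0\<close>, while \<open>A\<^sub>j\<close> Poisson commutes with \<open>G\<^sub>k\<close> and \<open>L\<^sub>k\<close> if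
  \<open>j \<noteq> k\<close> (lemmas \<open>trace_entrywise_bracket_Am_Gm\<close> and \<open>entrywise_bracket_Am_Lm\<close>). By the Leibniz
  rule, \<open>{tr (A\<^sub>i A\<^sub>j), G\<^sub>k}\<close> with \<open>i \<noteq> j\<close> is therefore \<open>A\<^sub>j G\<^sub>k\<close> if \<open>k = i\<close>, \<open>A\<^sub>i G\<^sub>k\<close> if \<open>k = j\<close>, and \<open>0\<close>
  otherwise; summing these with the weights of the Hamiltonian gives the Schlesinger field. The
  matrices \<open>A\<^sub>i\<close> are traceless because \<open>L\<^sub>i\<close> is.

  The moment map property comes from the following cancellation. For a derivation \<open>D = {\<cdot>, g}\<close>,
  one has \<open>D A = G (G\<^sup>-\<^sup>1 (D G) L - L G\<^sup>-\<^sup>1 (D G) + D L) G\<^sup>-\<^sup>1\<close>.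
  For \<open>g = G\<^sub>c\<^sub>d\<close> the r-matrix bracket makes \<open>G\<^sup>-\<^sup>1 (D G)\<close> a matrix supported in row \<open>d\<close>, with entries
  \<open>- G\<^sub>c\<^sub>b / (\<lambda>\<^sub>d - \<lambda>\<^sub>b)\<close> off the diagonal; the commutator with \<open>L\<close> multiplies them by
  \<open>\<lambda>\<^sub>b - \<lambda>\<^sub>d\<close>, which removes the denominators. The entry at \<open>(d, d)\<close>, which the commutator
  misses, is supplied by \<open>D L\<close>, together with the scalar matrix \<open>- G\<^sub>c\<^sub>d / n\<close> that pairs to zero with
  traceless matrices. For \<open>g\<close> an entry of \<open>L\<close>, \<open>G\<^sup>-\<^sup>1 (D G)\<close>
  is diagonal, commutes with \<open>L\<close>, and nothing is left.

  To apply the Leibniz rule to \<open>A\<close>, its entries must belong to the algebra on which the bracket is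
  defined. This is a matter of \<open>G\<^sup>-\<^sup>1\<close> only: on \<open>det G = 1\<close>, its entries are polynomials in those of
  \<open>G\<close> by Cramer's rule, and membership is decided by the values on the phase space.
\<close>

section \<open>Matrix identities\<close>

lemma matrix_mult_add_right: "(A + B) ** C = A ** C + B ** (C :: 'a::semiring_1^'p^'n)"
  by (simp add: vec_eq_iff matrix_matrix_mult_def distrib_right sum.distrib)

lemma matrix_mult_diff_right: "(A - B) ** C = A ** C - B ** (C :: 'a::ring_1^'p^'n)"
  by (simp add: vec_eq_iff matrix_matrix_mult_def left_diff_distrib sum_subtractf)

lemma matrix_mult_diff_left: "(A :: 'a::ring_1^'n^'m) ** (B - C) = A ** B - A ** C"
  by (simp add: vec_eq_iff matrix_matrix_mult_def right_diff_distrib sum_subtractf)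

lemma matrix_mult_minus_right: "(A :: 'a::ring_1^'n^'m) ** (- B) = - (A ** B)"
  by (simp add: vec_eq_iff matrix_matrix_mult_def sum_negf)

lemma diagonal_mult_left:
  fixes A :: "'a::semiring_1^'n^'n"
  assumes "\<And>a b. a \<noteq> b \<Longrightarrow> D $ a $ b = 0"
  shows "(D ** A) $ a $ b = D $ a $ a * A $ a $ b"
proof -
  have "(D ** A) $ a $ b = (\<Sum>c\<in>UNIV. if c = a then D $ a $ c * A $ c $ b else 0)"
    unfolding matrix_matrix_mult_def vec_lambda_beta using assms by (intro sum.cong) auto
  then show ?thesis by simp
qed

lemma diagonal_mult_right:
  fixes A :: "'a::semiring_1^'n^'n"
  assumes "\<And>a b. a \<noteq> b \<Longrightarrow> D $ a $ b = 0"
  shows "(A ** D) $ a $ b = A $ a $ b * D $ b $ b"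
proof -
  have "(A ** D) $ a $ b = (\<Sum>c\<in>UNIV. if c = b then A $ a $ c * D $ c $ b else 0)"
    unfolding matrix_matrix_mult_def vec_lambda_beta using assms by (intro sum.cong) auto
  then show ?thesis by simp
qed

lemma matrix_inv_works:
  fixes A :: "'a::field^'n^'n"
  assumes "det A \<noteq> 0"
  shows "A ** matrix_inv A = mat 1" "matrix_inv A ** A = mat 1"
proof -
  have "\<exists>B. A ** B = mat 1 \<and> B ** A = mat 1"
    using assms by (simp add: invertible_det_nz flip: invertible_def)
  then have "A ** matrix_inv A = mat 1 \<and> matrix_inv A ** A = mat 1"
    unfolding matrix_inv_def by (rule someI_ex)
  then show "A ** matrix_inv A = mat 1" "matrix_inv A ** A = mat 1" by auto
qed

text \<open>Without the division by the determinant in Cramer's rule, the right-hand side is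
  polynomial in the entries of \<open>A\<close>. This is how the entries of the inverse are seen to be
  holomorphic.\<close>

lemma matrix_inv_cramer:
  fixes A :: "'a::field^'n^'n"
  assumes "det A = 1"
  shows "matrix_inv A $ a $ b
     = det (\<chi> i j. if j = a then (if i = b then 1 else 0) else A $ i $ j)"
proof -
  have "(A ** matrix_inv A) $ i $ b = (if i = b then 1 else 0)" for i
    using assms by (simp add: matrix_inv_works mat_def)
  then have "A *v (\<chi> k. matrix_inv A $ k $ b) = (\<chi> i. if i = b then 1 else 0)"
    by (simp add: vec_eq_iff matrix_vector_mult_def matrix_matrix_mult_def)
  then have "(\<chi> k. matrix_inv A $ k $ b)
      = (\<chi> k. det (\<chi> i j. if j = k then (\<chi> i. if i = b then 1 else 0) $ i else A $ i $ j) / det A)"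
    using assms by (subst (asm) cramer) auto
  then show ?thesis
    using assms by (simp add: vec_eq_iff cong: if_cong)
qed

lemma sum_UNIV_pair: "(\<Sum>p\<in>UNIV. f p) = (\<Sum>a\<in>UNIV. \<Sum>b\<in>UNIV. f (a, b))"
  for f :: "'n::finite \<times> 'm::finite \<Rightarrow> 'a::comm_monoid_add"
  by (simp add: sum.cartesian_product)

lemma kron_mult: "(A \<otimes>\<^sub>k B) ** (C \<otimes>\<^sub>k D) = (A ** C) \<otimes>\<^sub>k (B ** D)"
  by (simp add: vec_eq_iff kron_def matrix_matrix_mult_def sum_UNIV_pair sum_product mult_ac)

lemma left_right_factor: "left_factor A ** right_factor B = A \<otimes>\<^sub>k B"
  by (simp add: left_factor_def right_factor_def kron_mult)

section \<open>Derivations of matrices over a Poisson algebra\<close>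

text \<open>The axioms of a Poisson bracket do not say that \<open>\<F>\<close> is an algebra. The closure
  condition \<open>cong_closed\<close> expresses that \<open>\<F>\<close> really is an algebra of functions on \<open>M\<close>; it lets one
  replace a function by a polynomial expression that agrees with it on \<open>M\<close> alone.\<close>

locale poisson_function_algebra = poisson_bracket +
  assumes const_closed: "(\<lambda>_. c) \<in> \<F>"
    and add_closed: "\<lbrakk>f \<in> \<F>; g \<in> \<F>\<rbrakk> \<Longrightarrow> (\<lambda>y. f y + g y) \<in> \<F>"
    and cong_closed: "\<lbrakk>f \<in> \<F>; \<And>y. y \<in> M \<Longrightarrow> f y = g y\<rbrakk> \<Longrightarrow> g \<in> \<F>"
    and mult_closed: "\<lbrakk>f \<in> \<F>; g \<in> \<F>\<rbrakk> \<Longrightarrow> (\<lambda>y. f y * g y) \<in> \<F>"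
begin

lemma sum_closed:
  assumes "finite I" and "\<And>i. i \<in> I \<Longrightarrow> f i \<in> \<F>"
  shows "(\<lambda>y. \<Sum>i\<in>I. f i y) \<in> \<F>"
  using assms by (induction I rule: finite_induct) (auto intro: const_closed add_closed)

lemma prod_closed:
  assumes "finite I" and "\<And>i. i \<in> I \<Longrightarrow> f i \<in> \<F>"
  shows "(\<lambda>y. \<Prod>i\<in>I. f i y) \<in> \<F>"
  using assms by (induction I rule: finite_induct) (auto intro: const_closed mult_closed)

lemma br_const:
  assumes g: "g \<in> \<F>" and x: "x \<in> M"
  shows "br (\<lambda>_. c) g x = 0"
proof -
  have "br (\<lambda>_. 1) g x = 0"
    using br_leibniz[OF const_closed[of 1] const_closed[of 1] g x] by simp
  then show ?thesis
    using br_scale[OF const_closed[of 1] g x, of c] by simp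
qed

lemma br_sum:
  assumes "finite I" and "\<And>i. i \<in> I \<Longrightarrow> f i \<in> \<F>" and g: "g \<in> \<F>" and x: "x \<in> M"
  shows "br (\<lambda>y. \<Sum>i\<in>I. f i y) g x = (\<Sum>i\<in>I. br (f i) g x)"
  using assms(1,2)
proof (induction I rule: finite_induct)
  case empty
  then show ?case using br_const[OF g x, of 0] by simp
next
  case (insert i I)
  then have "(\<lambda>y. \<Sum>i\<in>I. f i y) \<in> \<F>"
    by (intro sum_closed) auto
  with insert show ?case
    using br_add[OF _ _ g x, of "f i" "\<lambda>y. \<Sum>i\<in>I. f i y"] by simp
qed

definition matrix_algebra :: "('a \<Rightarrow> complex^'n^'m) set"
  where "matrix_algebra = {X. \<forall>a b. (\<lambda>y. X y $ a $ b) \<in> \<F>}"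

lemma matrix_algebraD: "X \<in> matrix_algebra \<Longrightarrow> (\<lambda>y. X y $ a $ b) \<in> \<F>"
  by (simp add: matrix_algebra_def)

lemma matrix_algebra_mult:
  assumes "X \<in> matrix_algebra" and "Y \<in> matrix_algebra"
  shows "(\<lambda>y. X y ** Y y) \<in> matrix_algebra"
  using assms
  by (auto simp: matrix_algebra_def matrix_matrix_mult_def intro!: sum_closed mult_closed)

lemma trace_closed:
  assumes "X \<in> matrix_algebra"
  shows "(\<lambda>y. trace (X y)) \<in> \<F>"
  using assms unfolding trace_def by (intro sum_closed) (auto intro: matrix_algebraD)

lemma det_closed:
  assumes "X \<in> matrix_algebra"
  shows "(\<lambda>y. det (X y)) \<in> \<F>"
  using assms unfolding det_def
  by (intro sum_closed mult_closed prod_closed const_closed finite_permutations)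
     (auto intro: matrix_algebraD)

text \<open>Bracketing with a fixed \<open>g\<close> from the right is a derivation of \<open>\<F>\<close>; extended to
  matrices it obeys the usual noncommutative rules for products and inverses.\<close>

definition entrywise_bracket :: "('a \<Rightarrow> complex^'n^'m) \<Rightarrow> ('a \<Rightarrow> complex) \<Rightarrow> 'a \<Rightarrow> complex^'n^'m"
  where "entrywise_bracket X g x = (\<chi> a b. br (\<lambda>y. X y $ a $ b) g x)"

lemma entrywise_bracket_mult:
  assumes X: "X \<in> matrix_algebra" and Y: "Y \<in> matrix_algebra" and g: "g \<in> \<F>" and x: "x \<in> M"
  shows "entrywise_bracket (\<lambda>y. X y ** Y y) g x
     = X x ** entrywise_bracket Y g x + entrywise_bracket X g x ** Y x"
proof -
  have "br (\<lambda>y. \<Sum>c\<in>UNIV. X y $ a $ c * Y y $ c $ b) g x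
      = (\<Sum>c\<in>UNIV. X x $ a $ c * br (\<lambda>y. Y y $ c $ b) g x
          + br (\<lambda>y. X y $ a $ c) g x * Y x $ c $ b)" for a b
    using X Y g x by (simp add: br_sum br_leibniz mult_closed matrix_algebraD)
  then show ?thesis
    by (simp add: entrywise_bracket_def vec_eq_iff matrix_matrix_mult_def sum.distrib)
qed

text \<open>Differentiate \<open>Y X = 1\<close>. The identity holds on \<open>M\<close> only, so the bracket of the product
  is compared with that of a constant through \<open>br_cong\<close>.\<close>

lemma entrywise_bracket_inverse:
  fixes X Y :: "'a \<Rightarrow> complex^'n^'n"
  assumes X: "X \<in> matrix_algebra" and Y: "Y \<in> matrix_algebra" and g: "g \<in> \<F>" and x: "x \<in> M"
    and inv: "\<And>y. y \<in> M \<Longrightarrow> Y y ** X y = mat 1"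
  shows "entrywise_bracket Y g x = - (Y x ** entrywise_bracket X g x ** Y x)"
proof -
  have "br (\<lambda>y. (Y y ** X y) $ a $ b) g x = br (\<lambda>y. (mat 1 :: complex^'n^'n) $ a $ b) g x" for a b
    using matrix_algebra_mult[OF Y X] g x inv
    by (intro br_cong) (auto intro: matrix_algebraD const_closed)
  then have "entrywise_bracket (\<lambda>y. Y y ** X y) g x = 0"
    using br_const[OF g x] by (simp add: entrywise_bracket_def vec_eq_iff)
  then have "Y x ** entrywise_bracket X g x + entrywise_bracket Y g x ** X x = 0"
    by (simp add: entrywise_bracket_mult[OF Y X g x])
  then have "(Y x ** entrywise_bracket X g x + entrywise_bracket Y g x ** X x) ** Y x = 0"
    by simp
  moreover have "X x ** Y x = mat 1"
    using inv[OF x] by (simp add: matrix_left_right_inverse)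
  ultimately have "Y x ** entrywise_bracket X g x ** Y x + entrywise_bracket Y g x = 0"
    by (simp add: matrix_mult_add_right flip: matrix_mul_assoc)
  then show ?thesis
    by (simp add: eq_neg_iff_add_eq_0 add.commute)
qed

lemma br_trace:
  assumes "X \<in> matrix_algebra" and "g \<in> \<F>" and "x \<in> M"
  shows "br (\<lambda>y. trace (X y)) g x = trace (entrywise_bracket X g x)"
  using assms by (simp add: trace_def entrywise_bracket_def br_sum matrix_algebraD)

text \<open>At points off \<open>M\<close> where \<open>X\<close> is singular, \<open>matrix_inv\<close> is an unspecified matrix, so it is
  replaced by the polynomial expression with which it agrees on \<open>M\<close>.\<close>

lemma matrix_inv_closed:
  fixes X :: "'a \<Rightarrow> complex^'n^'n"
  assumes X: "X \<in> matrix_algebra" and det: "\<And>y. y \<in> M \<Longrightarrow> det (X y) = 1"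
  shows "(\<lambda>y. matrix_inv (X y)) \<in> matrix_algebra"
  unfolding matrix_algebra_def
proof (intro CollectI allI)
  fix a b
  have "(\<lambda>y. if j = a then (if i = b then 1 else 0) else X y $ i $ j) \<in> \<F>" for i j
    by (cases "j = a") (simp_all add: const_closed matrix_algebraD[OF X])
  then have "(\<lambda>y. \<chi> i j. if j = a then (if i = b then 1 else 0) else X y $ i $ j) \<in> matrix_algebra"
    by (simp add: matrix_algebra_def)
  from det_closed[OF this] show "(\<lambda>y. matrix_inv (X y) $ a $ b) \<in> \<F>"
    by (rule cong_closed) (simp add: det matrix_inv_cramer)
qed

text \<open>The derivative of \<open>G L G\<^sup>-\<^sup>1\<close>, written in the frame of \<open>G\<close>, splits into a commutator with
  \<open>L\<close> and the derivative of \<open>L\<close>. For diagonal \<open>L\<close>, the commutator multiplies entries by differences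
  of eigenvalues, which will cancel the denominators of the r-matrix.\<close>

lemma entrywise_bracket_conjugate:
  fixes G L K :: "'a \<Rightarrow> complex^'n^'n"
  assumes G: "G \<in> matrix_algebra" and L: "L \<in> matrix_algebra" and K: "K \<in> matrix_algebra"
    and g: "g \<in> \<F>" and x: "x \<in> M" and inv: "\<And>y. y \<in> M \<Longrightarrow> K y ** G y = mat 1"
  shows "entrywise_bracket (\<lambda>y. G y ** L y ** K y) g x
     = G x ** (K x ** entrywise_bracket G g x ** L x - L x ** (K x ** entrywise_bracket G g x)
         + entrywise_bracket L g x) ** K x"
proof -
  have GK: "G x ** K x = mat 1"
    using inv[OF x] by (simp add: matrix_left_right_inverse)
  have "G x ** (K x ** Z) = Z" for Z :: "complex^'n^'n"
    by (simp add: matrix_mul_assoc GK)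
  moreover have "entrywise_bracket (\<lambda>y. G y ** L y ** K y) g x
      = G x ** L x ** - (K x ** entrywise_bracket G g x ** K x)
        + (G x ** entrywise_bracket L g x + entrywise_bracket G g x ** L x) ** K x"
    by (simp only: entrywise_bracket_mult[OF matrix_algebra_mult[OF G L] K g x]
        entrywise_bracket_mult[OF G L g x] entrywise_bracket_inverse[OF G K g x inv])
  ultimately show ?thesis
    by (simp add: matrix_mult_add_right matrix_mult_diff_right matrix_mult_diff_left
        matrix_add_ldistrib matrix_mult_minus_right flip: matrix_mul_assoc)
qed

end

section \<open>Holomorphic functions on the phase space\<close>

lemma ambient_holomorphic_subset:
  "ambient_holomorphic_on F U \<Longrightarrow> V \<subseteq> U \<Longrightarrow> ambient_holomorphic_on F V"
  by (auto simp: ambient_holomorphic_on_def)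

lemma ambient_holomorphic_const: "ambient_holomorphic_on (\<lambda>_. c) U"
  unfolding ambient_holomorphic_on_def
  by (intro ballI exI[of _ "\<lambda>_. 0"]) simp

lemma ambient_holomorphic_add:
  assumes "ambient_holomorphic_on F U" and "ambient_holomorphic_on G U"
  shows "ambient_holomorphic_on (\<lambda>x. F x + G x) U"
  unfolding ambient_holomorphic_on_def
proof
  fix x assume "x \<in> U"
  then obtain D E where "(F has_derivative D) (at x)" "\<forall>c v. D (ambient_scale c v) = c * D v"
      "(G has_derivative E) (at x)" "\<forall>c v. E (ambient_scale c v) = c * E v"
    using assms unfolding ambient_holomorphic_on_def by blast
  then show "\<exists>D. ((\<lambda>x. F x + G x) has_derivative D) (at x)
      \<and> (\<forall>c v. D (ambient_scale c v) = c * D v)"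
    by (intro exI[of _ "\<lambda>v. D v + E v"]) (simp add: has_derivative_add distrib_left)
qed

lemma ambient_holomorphic_mult:
  assumes "ambient_holomorphic_on F U" and "ambient_holomorphic_on G U"
  shows "ambient_holomorphic_on (\<lambda>x. F x * G x) U"
  unfolding ambient_holomorphic_on_def
proof
  fix x assume "x \<in> U"
  then obtain D E where "(F has_derivative D) (at x)" "\<forall>c v. D (ambient_scale c v) = c * D v"
      "(G has_derivative E) (at x)" "\<forall>c v. E (ambient_scale c v) = c * E v"
    using assms unfolding ambient_holomorphic_on_def by blast
  then show "\<exists>D. ((\<lambda>x. F x * G x) has_derivative D) (at x)
      \<and> (\<forall>c v. D (ambient_scale c v) = c * D v)"
    by (intro exI[of _ "\<lambda>v. F x * E v + D v * G x"] conjI has_derivative_mult)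
       (simp_all add: algebra_simps)
qed

lemma ambient_holomorphic_linear:
  assumes "bounded_linear F" and "\<And>c v. F (ambient_scale c v) = c * F v"
  shows "ambient_holomorphic_on F U"
  unfolding ambient_holomorphic_on_def
  using assms bounded_linear_imp_has_derivative by blast

lemma phase_holomorphic_ambient:
  "ambient_holomorphic_on F UNIV \<Longrightarrow> F \<in> phase_holomorphic"
  unfolding phase_holomorphic_def by (intro CollectI ballI exI[of _ UNIV] exI[of _ F]) simp

lemma phase_holomorphic_cong:
  assumes "f \<in> phase_holomorphic" and "\<And>x. x \<in> phase_space \<Longrightarrow> f x = g x"
  shows "g \<in> phase_holomorphic"
  using assms unfolding phase_holomorphic_def by simp

text \<open>Two functions have local holomorphic extensions on different neighbourhoods; on the
  intersection any operation that preserves holomorphy can be applied to the extensions.\<close>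

lemma phase_holomorphic_combine:
  fixes f g :: "('n::finite, 'm::finite) ambient \<Rightarrow> complex"
  assumes f: "f \<in> phase_holomorphic" and g: "g \<in> phase_holomorphic"
    and op: "\<And>(F :: ('n, 'm) ambient \<Rightarrow> complex) G U. \<lbrakk>ambient_holomorphic_on F U; ambient_holomorphic_on G U\<rbrakk>
      \<Longrightarrow> ambient_holomorphic_on (\<lambda>x. op (F x) (G x)) U"
  shows "(\<lambda>x. op (f x) (g x)) \<in> phase_holomorphic"
  unfolding phase_holomorphic_def
proof (intro CollectI ballI)
  fix p :: "('n, 'm) ambient" assume p: "p \<in> phase_space"
  obtain U F where U: "open U" "p \<in> U" "ambient_holomorphic_on F U"
      "\<forall>x\<in>U \<inter> phase_space. F x = f x"
    using f p unfolding phase_holomorphic_def by blast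
  obtain V G where V: "open V" "p \<in> V" "ambient_holomorphic_on G V"
      "\<forall>x\<in>V \<inter> phase_space. G x = g x"
    using g p unfolding phase_holomorphic_def by blast
  have "ambient_holomorphic_on (\<lambda>x. op (F x) (G x)) (U \<inter> V)"
    by (rule op[where F = F and G = G])
       (auto intro: ambient_holomorphic_subset[OF U(3)] ambient_holomorphic_subset[OF V(3)])
  with U V show "\<exists>W H. open W \<and> p \<in> W \<and> ambient_holomorphic_on H W
      \<and> (\<forall>x\<in>W \<inter> phase_space. H x = op (f x) (g x))"
    by (intro exI[of _ "U \<inter> V"] exI[of _ "\<lambda>x. op (F x) (G x)"]) auto
qed

lemma bounded_linear_entry: "bounded_linear (\<lambda>A :: complex^'n^'m. A $ a $ b)"
  by (intro bounded_linear_compose[OF bounded_linear_vec_nth] bounded_linear_vec_nth)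

lemma Gm_entry_holomorphic: "(\<lambda>x. Gm k x $ a $ b) \<in> phase_holomorphic"
  unfolding Gm_def
  by (intro phase_holomorphic_ambient ambient_holomorphic_linear
      bounded_linear_compose[OF bounded_linear_entry] bounded_linear_compose[OF bounded_linear_fst]
      bounded_linear_vec_nth)
     (simp add: ambient_scale_def cscale_def Gm_def)

lemma Lm_entry_holomorphic: "(\<lambda>x. Lm k x $ a $ b) \<in> phase_holomorphic"
  unfolding Lm_def
  by (intro phase_holomorphic_ambient ambient_holomorphic_linear
      bounded_linear_compose[OF bounded_linear_entry] bounded_linear_compose[OF bounded_linear_snd]
      bounded_linear_vec_nth)
     (simp add: ambient_scale_def cscale_def Lm_def)

section \<open>The brackets of the coordinates\<close>

lemma tensor_bracket_nth:
  "tensor_bracket br X Y x $ (a, c) $ (b, d) = br (\<lambda>y. X y $ a $ b) (\<lambda>y. Y y $ c $ d) x"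
proof -
  have "tensor_bracket br X Y x $ (a, c) $ (b, d)
      = (\<Sum>p\<in>UNIV. \<Sum>q\<in>UNIV. \<Sum>r\<in>UNIV. \<Sum>s\<in>UNIV.
          if s = d then if r = c then if q = b then if p = a then
            br (\<lambda>y. X y $ p $ q) (\<lambda>y. Y y $ r $ s) x else 0 else 0 else 0 else 0)"
    unfolding tensor_bracket_def sum_component
    by (intro sum.cong refl) (auto simp: cscale_def kron_def matrix_unit_def)
  also have "\<dots> = br (\<lambda>y. X y $ a $ b) (\<lambda>y. Y y $ c $ d) x"
    by (simp add: sum.delta)
  finally show ?thesis .
qed

lemma kron_matrix_unit_nth:
  "(matrix_unit i j \<otimes>\<^sub>k matrix_unit k l) $ (p, q) $ (b, d)
     = (if p = i \<and> q = k \<and> b = j \<and> d = l then 1 else 0)"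
  by (auto simp: kron_def matrix_unit_def)

lemma r_matrix_summand_nth:
  fixes L :: "complex^'n::{finite,linorder}^'n::{finite,linorder}"
  assumes less: "i < j"
  shows "((1 / (L $ i $ i - L $ j $ j)) *\<^sub>m (matrix_unit i j \<otimes>\<^sub>k matrix_unit j i
        - matrix_unit j i \<otimes>\<^sub>k matrix_unit i j)) $ (p, q) $ (b, d)
      = (if j = b then if i = d then if p = d \<and> q = b then 1 / (L $ d $ d - L $ b $ b) else 0 else 0 else 0)
      + (if j = d then if i = b then if p = d \<and> q = b then 1 / (L $ d $ d - L $ b $ b) else 0 else 0 else 0)"
proof -
  have neg: "- (1 / (L $ b $ b - L $ d $ d)) = 1 / (L $ d $ d - L $ b $ b)"
    by (metis minus_diff_eq minus_divide_right)
  consider "i = d \<and> j = b" | "i = b \<and> j = d" | "\<not> (i = d \<and> j = b)" "\<not> (i = b \<and> j = d)"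
    by blast
  then show ?thesis
  proof cases
    case 1
    with less have "b \<noteq> d" by auto
    with 1 show ?thesis by (simp add: cscale_def kron_matrix_unit_nth)
  next
    case 2
    with less have "b \<noteq> d" by auto
    with 2 neg show ?thesis by (simp add: cscale_def kron_matrix_unit_nth)
  next
    case 3
    then show ?thesis by (simp add: cscale_def kron_matrix_unit_nth)
  qed
qed

text \<open>The two summands of the r-matrix for \<open>i < j\<close> give the entries with \<open>d < b\<close> and with \<open>b < d\<close>,
  and the sign in front of the second turns \<open>1 / (\<lambda>\<^sub>b - \<lambda>\<^sub>d)\<close> into \<open>1 / (\<lambda>\<^sub>d - \<lambda>\<^sub>b)\<close>, so that the order
  of the indices drops out. For \<open>b = d\<close> the entry vanishes, in agreement with \<open>1 / 0 = 0\<close>.\<close>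

lemma r_matrix_nth:
  fixes L :: "complex^'n::{finite,linorder}^'n::{finite,linorder}"
  shows "r_matrix L $ (p, q) $ (b, d)
     = (if p = d \<and> q = b then 1 / (L $ d $ d - L $ b $ b) else 0)"
proof -
  define v where "v = (if p = d \<and> q = b then 1 / (L $ d $ d - L $ b $ b) else 0)"
  have filter: "(\<Sum>j\<in>{j. i < j}. f j) = (\<Sum>j\<in>UNIV. if i < j then f j else 0)"
    for i :: 'n and f :: "'n \<Rightarrow> complex"
    by (simp add: sum.If_cases)
  have "r_matrix L $ (p, q) $ (b, d) = (\<Sum>i\<in>UNIV. \<Sum>j\<in>UNIV. if i < j then
      (if j = b then if i = d then v else 0 else 0)
      + (if j = d then if i = b then v else 0 else 0) else 0)"
    unfolding r_matrix_def sum_component filter v_def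
    by (intro sum.cong refl if_cong r_matrix_summand_nth)
  also have "\<dots> = (\<Sum>i\<in>UNIV. \<Sum>j\<in>UNIV.
      (if j = b then if i = d then if d < b then v else 0 else 0 else 0)
      + (if j = d then if i = b then if b < d then v else 0 else 0 else 0))"
    by (intro sum.cong refl) auto
  also have "\<dots> = (if d < b then v else 0) + (if b < d then v else 0)"
    by (simp add: sum.distrib)
  also have "\<dots> = v"
    by (cases b d rule: linorder_cases) (auto simp: v_def)
  finally show ?thesis
    unfolding v_def .
qed

lemma Omega_nth:
  "(Omega :: complex^('n::finite \<times> 'n)^('n \<times> 'n)) $ (p, q) $ (b, d)
     = (if p = b \<and> q = d then (if b = d then 1 else 0) - 1 / of_nat CARD('n) else 0)"
proof -
  have "(\<Sum>i\<in>UNIV. (matrix_unit i i \<otimes>\<^sub>k matrix_unit i i) $ (p, q) $ (b, d) :: complex)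
      = (\<Sum>i\<in>UNIV. if i = b then if p = b \<and> q = d \<and> b = d then 1 else 0 else 0)"
    by (intro sum.cong refl) (auto simp: kron_matrix_unit_nth)
  also have "\<dots> = (if p = b \<and> q = d \<and> b = d then 1 else 0)"
    by simp
  finally have "(Omega :: complex^('n \<times> 'n)^('n \<times> 'n)) $ (p, q) $ (b, d)
      = (if p = b \<and> q = d \<and> b = d then 1 else 0)
        - ((1 / of_nat CARD('n)) *\<^sub>m (mat 1 \<otimes>\<^sub>k mat 1)) $ (p, q) $ (b, d)"
    by (simp only: Omega_def vector_minus_component sum_component)
  then show ?thesis
    by (auto simp: cscale_def kron_def mat_def)
qed

lemma is_phase_poisson_algebra:
  assumes "is_phase_poisson br"
  shows "poisson_function_algebra phase_space phase_holomorphic br"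
proof -
  have "poisson_bracket phase_space phase_holomorphic br"
    using assms by (simp add: is_phase_poisson_def)
  then show ?thesis
    by (intro poisson_function_algebra.intro poisson_function_algebra_axioms.intro)
       (auto intro: phase_holomorphic_ambient ambient_holomorphic_const phase_holomorphic_cong
          phase_holomorphic_combine[where op = "(+)"] phase_holomorphic_combine[where op = "(*)"]
          ambient_holomorphic_add ambient_holomorphic_mult)
qed

locale phase_poisson =
  fixes br :: "(('n::{finite,linorder}, 'm::finite) ambient \<Rightarrow> complex)
      \<Rightarrow> (('n, 'm) ambient \<Rightarrow> complex) \<Rightarrow> ('n, 'm) ambient \<Rightarrow> complex"
  assumes phase_poisson: "is_phase_poisson br"

sublocale phase_poisson \<subseteq> poisson_function_algebra phase_space phase_holomorphic br
  by (rule is_phase_poisson_algebra[OF phase_poisson])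

context phase_poisson
begin

lemma Gm_in_matrix_algebra: "Gm k \<in> matrix_algebra"
  by (simp add: matrix_algebra_def Gm_entry_holomorphic)

lemma Lm_in_matrix_algebra: "Lm k \<in> matrix_algebra"
  by (simp add: matrix_algebra_def Lm_entry_holomorphic)

lemma det_Gm: "x \<in> phase_space \<Longrightarrow> det (Gm k x) = 1"
  by (simp add: phase_space_def)

lemma Gm_inverse_in_matrix_algebra: "(\<lambda>x. matrix_inv (Gm k x)) \<in> matrix_algebra"
  by (rule matrix_inv_closed[OF Gm_in_matrix_algebra det_Gm])

lemma Am_in_matrix_algebra: "Am k \<in> matrix_algebra"
  unfolding Am_def
  by (intro matrix_algebra_mult Gm_in_matrix_algebra Lm_in_matrix_algebra
      Gm_inverse_in_matrix_algebra)

lemma br_Gm_Gm: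
  assumes "x \<in> phase_space"
  shows "br (\<lambda>y. Gm j y $ a $ b) (\<lambda>y. Gm k y $ c $ d) x
     = (if j = k then - (Gm k x $ a $ d * Gm k x $ c $ b / (Lm k x $ d $ d - Lm k x $ b $ b)) else 0)"
proof -
  have "((Gm k x \<otimes>\<^sub>k Gm k x) ** r_matrix (Lm k x)) $ (a, c) $ (b, d)
      = (\<Sum>p\<in>UNIV. \<Sum>q\<in>UNIV. if q = b then if p = d then
          Gm k x $ a $ d * Gm k x $ c $ b / (Lm k x $ d $ d - Lm k x $ b $ b) else 0 else 0)"
    unfolding matrix_matrix_mult_def vec_lambda_beta sum_UNIV_pair
    by (intro sum.cong refl) (auto simp: kron_def r_matrix_nth)
  also have "\<dots> = Gm k x $ a $ d * Gm k x $ c $ b / (Lm k x $ d $ d - Lm k x $ b $ b)"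
    by (simp add: sum.delta)
  finally have "((Gm k x \<otimes>\<^sub>k Gm k x) ** r_matrix (Lm k x)) $ (a, c) $ (b, d)
      = Gm k x $ a $ d * Gm k x $ c $ b / (Lm k x $ d $ d - Lm k x $ b $ b)" .
  moreover have "tensor_bracket br (Gm j) (Gm k) x
      = (if j = k then - ((Gm k x \<otimes>\<^sub>k Gm k x) ** r_matrix (Lm k x)) else 0)"
    using phase_poisson assms by (auto simp: is_phase_poisson_def left_right_factor)
  ultimately show ?thesis
    using tensor_bracket_nth[of br "Gm j" "Gm k" x a c b d] by (cases "j = k") simp_all
qed

lemma br_Gm_Lm:
  assumes "x \<in> phase_space"
  shows "br (\<lambda>y. Gm j y $ a $ b) (\<lambda>y. Lm k y $ c $ d) x
     = (if j = k \<and> c = d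
        then - (Gm k x $ a $ b * ((if b = d then 1 else 0) - 1 / of_nat CARD('n))) else 0)"
proof -
  have "(left_factor (Gm k x) ** Omega) $ (a, c) $ (b, d)
      = (\<Sum>p\<in>UNIV. \<Sum>q\<in>UNIV. if q = d then if p = b then if c = d then
          Gm k x $ a $ b * ((if b = d then 1 else 0) - 1 / of_nat CARD('n)) else 0 else 0 else 0)"
    unfolding matrix_matrix_mult_def vec_lambda_beta sum_UNIV_pair
    by (intro sum.cong refl) (auto simp: kron_def Omega_nth left_factor_def mat_def)
  also have "\<dots> = (if c = d then
      Gm k x $ a $ b * ((if b = d then 1 else 0) - 1 / of_nat CARD('n)) else 0)"
    by (simp add: sum.delta)
  finally have "(left_factor (Gm k x) ** Omega) $ (a, c) $ (b, d)
      = (if c = d then Gm k x $ a $ b * ((if b = d then 1 else 0) - 1 / of_nat CARD('n)) else 0)" .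
  moreover have "tensor_bracket br (Gm j) (Lm k) x
      = (if j = k then - (left_factor (Gm k x) ** Omega) else 0)"
    using phase_poisson assms by (auto simp: is_phase_poisson_def)
  ultimately show ?thesis
    using tensor_bracket_nth[of br "Gm j" "Lm k" x a c b d] 
    by (cases "j = k"; cases "c = d") simp_all
qed

lemma br_Lm_Lm:
  assumes "x \<in> phase_space"
  shows "br (\<lambda>y. Lm j y $ a $ b) (\<lambda>y. Lm k y $ c $ d) x = 0"
proof -
  have "tensor_bracket br (Lm j) (Lm k) x = 0"
    using phase_poisson assms by (auto simp: is_phase_poisson_def)
  then show ?thesis
    using tensor_bracket_nth[of br "Lm j" "Lm k" x a c b d] by simp
qed

lemma br_Lm_Gm:
  assumes "x \<in> phase_space"
  shows "br (\<lambda>y. Lm j y $ a $ b) (\<lambda>y. Gm k y $ c $ d) x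
     = (if j = k \<and> a = b
        then Gm k x $ c $ d * ((if d = b then 1 else 0) - 1 / of_nat CARD('n)) else 0)"
  using br_skew[OF Lm_entry_holomorphic Gm_entry_holomorphic assms, of j a b k c d]
  by (auto simp: br_Gm_Lm[OF assms])

section \<open>The moment map of left translations\<close>

lemma entrywise_bracket_Am:
  assumes "g \<in> phase_holomorphic" and x: "x \<in> phase_space"
  shows "entrywise_bracket (Am j) g x
     = Gm j x ** (matrix_inv (Gm j x) ** entrywise_bracket (Gm j) g x ** Lm j x
         - Lm j x ** (matrix_inv (Gm j x) ** entrywise_bracket (Gm j) g x)
         + entrywise_bracket (Lm j) g x) ** matrix_inv (Gm j x)"
  unfolding Am_def
  by (rule entrywise_bracket_conjugate[OF Gm_in_matrix_algebra Lm_in_matrix_algebra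
        Gm_inverse_in_matrix_algebra assms]) (simp add: matrix_inv_works det_Gm)

text \<open>In tensor notation, this is the bracket of \<open>A\<close> and \<open>G\<close> as \<open>P - 1/n\<close> times the
  right factor of \<open>G\<close>, where \<open>P\<close> is the permutation of the tensor factors: \<open>A\<close> generates the
  infinitesimal left translations by traceless matrices.\<close>

lemma entrywise_bracket_Am_Gm:
  assumes x: "x \<in> phase_space"
  shows "entrywise_bracket (Am j) (\<lambda>y. Gm k y $ c $ d) x
     = (if j = k then (\<chi> p q. (if q = c then Gm k x $ p $ d else 0)
          - (if p = q then Gm k x $ c $ d / of_nat CARD('n) else 0)) else 0)"
proof (cases "j = k")
  case False
  then have "entrywise_bracket (Gm j) (\<lambda>y. Gm k y $ c $ d) x = 0"
    and "entrywise_bracket (Lm j) (\<lambda>y. Gm k y $ c $ d) x = 0"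
    by (simp_all add: entrywise_bracket_def br_Gm_Gm[OF x] br_Lm_Gm[OF x] vec_eq_iff)
  with False show ?thesis
    by (simp add: entrywise_bracket_Am[OF Gm_entry_holomorphic x])
next
  case True
  define G L K where "G = Gm k x" and "L = Lm k x" and "K = matrix_inv (Gm k x)"
  define X where "X = entrywise_bracket (Gm k) (\<lambda>y. Gm k y $ c $ d) x"
  define Y where "Y = entrywise_bracket (Lm k) (\<lambda>y. Gm k y $ c $ d) x"
  have diag: "\<And>a b. a \<noteq> b \<Longrightarrow> L $ a $ b = 0"
    and distinct: "\<And>a b. a \<noteq> b \<Longrightarrow> L $ a $ a \<noteq> L $ b $ b"
    using x by (auto simp: phase_space_def L_def)
  \<comment> \<open>The nonzero row of \<open>G\<^sup>-\<^sup>1 (D G)\<close>; its entry at \<open>b = d\<close> is zero, since \<open>1 / 0 = 0\<close>.\<close>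
  define s where "s b = - (G $ c $ b / (L $ d $ d - L $ b $ b))" for b
  have s_cancel: "s b * (L $ b $ b - L $ d $ d) = (if b = d then 0 else G $ c $ b)" for b
  proof (cases "b = d")
    case False
    then have "L $ d $ d - L $ b $ b \<noteq> 0"
      using distinct by auto
    moreover have "s b * (L $ b $ b - L $ d $ d)
        = G $ c $ b / (L $ d $ d - L $ b $ b) * (L $ d $ d - L $ b $ b)"
      unfolding s_def by (metis minus_diff_eq minus_mult_minus)
    ultimately show ?thesis
      using False by simp
  qed simp
  have X: "X $ a $ b = G $ a $ d * s b" for a b
    by (simp add: s_def X_def entrywise_bracket_def br_Gm_Gm[OF x] G_def L_def)
  have Y: "Y $ a $ b = (if a = b then
      G $ c $ d * ((if d = b then 1 else 0) - 1 / of_nat CARD('n)) else 0)" for a b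
    by (simp add: Y_def entrywise_bracket_def br_Lm_Gm[OF x] G_def)
  have GK: "G ** K = mat 1" and KG: "K ** G = mat 1"
    unfolding G_def K_def by (simp_all add: matrix_inv_works det_Gm[OF x])
  have KX: "(K ** X) $ e $ b = (if e = d then s b else 0)" for e b
  proof -
    have "(K ** X) $ e $ b = (K ** G) $ e $ d * s b"
      by (simp add: matrix_matrix_mult_def X sum_distrib_right mult.assoc)
    then show ?thesis
      by (simp add: KG mat_def)
  qed
  define C where "C = K ** X ** L - L ** (K ** X) + Y"
  \<comment> \<open>The commutator gives the entries of row \<open>d\<close> off the diagonal, \<open>Y\<close> the one at
    \<open>(d, d)\<close> and the scalar matrix.\<close>
  have C: "C $ e $ b = (if e = d then G $ c $ b else 0)
      - (if e = b then G $ c $ d / of_nat CARD('n) else 0)" for e b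
  proof -
    have "C $ e $ b = (K ** X) $ e $ b * (L $ b $ b - L $ e $ e) + Y $ e $ b"
      by (simp add: C_def diagonal_mult_left[OF diag] diagonal_mult_right[OF diag] algebra_simps)
    also have "(K ** X) $ e $ b * (L $ b $ b - L $ e $ e)
        = (if e = d \<and> b \<noteq> d then G $ c $ b else 0)"
      by (simp add: KX s_cancel)
    finally show ?thesis
      by (auto simp: Y right_diff_distrib)
  qed
  define v where "v = G $ c $ d / of_nat CARD('n)"
  have "(G ** C ** K) $ p $ q = (if q = c then G $ p $ d else 0)
      - (if p = q then G $ c $ d / of_nat CARD('n) else 0)" for p q
  proof -
    have "(G ** C) $ p $ b = (\<Sum>e\<in>UNIV. (if e = d then G $ p $ e * G $ c $ b else 0)
        - (if e = b then G $ p $ e * v else 0))" for b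
      unfolding matrix_matrix_mult_def vec_lambda_beta
      by (intro sum.cong refl) (auto simp: C v_def right_diff_distrib)
    then have "(G ** C) $ p $ b
        = G $ p $ d * G $ c $ b - G $ p $ b * v" for b
      by (simp add: sum_subtractf)
    then have "(G ** C) $ p $ b * K $ b $ q
        = G $ p $ d * (G $ c $ b * K $ b $ q) - G $ p $ b * K $ b $ q * v" for b
      by (simp add: left_diff_distrib right_diff_distrib mult_ac)
    then have "(G ** C ** K) $ p $ q = G $ p $ d * (G ** K) $ c $ q - (G ** K) $ p $ q * v"
      unfolding matrix_matrix_mult_def[of "G ** C"] matrix_matrix_mult_def[of G K]
      by (simp add: sum_subtractf sum_distrib_left sum_distrib_right)
    then show ?thesis
      by (auto simp: GK mat_def v_def)
  qed
  then show ?thesis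
    using entrywise_bracket_Am[OF Gm_entry_holomorphic x, of k k c d] True
    by (simp add: vec_eq_iff G_def L_def K_def X_def Y_def C_def)
qed

text \<open>Left translations do not move \<open>L\<close>. The brackets with an entry of \<open>L\<close> only rescale the
  columns of \<open>G\<close>, by the factors \<open>w\<close>, and such a rescaling does not change \<open>G L G\<^sup>-\<^sup>1\<close> when
  \<open>L\<close> is diagonal.\<close>

lemma entrywise_bracket_Am_Lm:
  assumes x: "x \<in> phase_space"
  shows "entrywise_bracket (Am j) (\<lambda>y. Lm k y $ c $ d) x = 0"
proof -
  define G L K where "G = Gm j x" and "L = Lm j x" and "K = matrix_inv (Gm j x)"
  define X where "X = entrywise_bracket (Gm j) (\<lambda>y. Lm k y $ c $ d) x"
  define w where "w b = (if j = k \<and> c = d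
      then - ((if b = d then 1 else 0) - 1 / of_nat CARD('n)) else 0 :: complex)" for b
  have KG: "K ** G = mat 1"
    unfolding G_def K_def by (simp add: matrix_inv_works det_Gm[OF x])
  have diag: "\<And>a b. a \<noteq> b \<Longrightarrow> L $ a $ b = 0"
    using x by (auto simp: phase_space_def L_def)
  have "X $ a $ b = G $ a $ b * w b" for a b
    by (simp add: X_def entrywise_bracket_def br_Gm_Lm[OF x] G_def w_def algebra_simps)
  then have "(K ** X) $ e $ b = (K ** G) $ e $ b * w b" for e b
    by (simp add: matrix_matrix_mult_def sum_distrib_right mult.assoc)
  then have "K ** X ** L - L ** (K ** X) = 0"
    by (simp add: vec_eq_iff diagonal_mult_left[OF diag] diagonal_mult_right[OF diag] KG mat_def)
  moreover have "entrywise_bracket (Lm j) (\<lambda>y. Lm k y $ c $ d) x = 0"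
    by (simp add: entrywise_bracket_def br_Lm_Lm[OF x] vec_eq_iff)
  ultimately show ?thesis
    using entrywise_bracket_Am[OF Lm_entry_holomorphic x, of j k c d]
    by (simp add: G_def L_def K_def X_def)
qed

lemma trace_Am:
  assumes x: "x \<in> phase_space"
  shows "trace (Am k x) = 0"
proof -
  have "trace (Am k x) = trace (matrix_inv (Gm k x) ** (Gm k x ** Lm k x))"
    unfolding Am_def by (rule trace_mul_sym)
  also have "\<dots> = trace (Lm k x)"
    by (simp add: matrix_mul_assoc matrix_inv_works det_Gm[OF x])
  finally show ?thesis
    using x by (simp add: phase_space_def)
qed

section \<open>Hamiltonian form of the Schlesinger system\<close>

text \<open>Pairing with \<open>M\<close> turns the permutation into multiplication by \<open>M\<close>. The scalar part of
  the bracket contributes a multiple of \<open>trace M\<close>, which is why \<open>M\<close> has to be traceless.\<close>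

lemma trace_entrywise_bracket_Am_Gm:
  assumes x: "x \<in> phase_space" and M: "trace M = 0"
  shows "trace (M ** entrywise_bracket (Am j) (\<lambda>y. Gm k y $ c $ d) x)
     = (if j = k then (M ** Gm k x) $ c $ d else 0)"
proof (cases "j = k")
  case True
  define v where "v = Gm k x $ c $ d / of_nat CARD('n)"
  have "(M ** entrywise_bracket (Am j) (\<lambda>y. Gm k y $ c $ d) x) $ i $ i
      = (if i = c then (M ** Gm k x) $ c $ d else 0) - M $ i $ i * v" for i
  proof -
    have "(M ** entrywise_bracket (Am j) (\<lambda>y. Gm k y $ c $ d) x) $ i $ i
        = (\<Sum>p\<in>UNIV. (if i = c then M $ i $ p * Gm k x $ p $ d else 0)
            - (if p = i then M $ i $ p * v else 0))"
      unfolding matrix_matrix_mult_def vec_lambda_beta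
      by (intro sum.cong refl)
         (auto simp: entrywise_bracket_Am_Gm[OF x] True v_def right_diff_distrib)
    then show ?thesis
      by (simp add: sum_subtractf matrix_matrix_mult_def)
  qed
  then have "trace (M ** entrywise_bracket (Am j) (\<lambda>y. Gm k y $ c $ d) x)
      = (M ** Gm k x) $ c $ d - trace M * v"
    by (simp add: trace_def sum_subtractf sum_distrib_right)
  then show ?thesis
    using M True by simp
qed (simp add: entrywise_bracket_Am_Gm[OF x] trace_def)

lemma br_schlesinger_hamiltonian:
  assumes g: "g \<in> phase_holomorphic" and x: "x \<in> phase_space"
  shows "br (schlesinger_hamiltonian t j) g x
     = (\<Sum>i\<in>UNIV - {j}. 1 / (t $ j - t $ i) *
          (trace (Am i x ** entrywise_bracket (Am j) g x)
           + trace (Am j x ** entrywise_bracket (Am i) g x)))"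
proof -
  have prod: "(\<lambda>y. Am i y ** Am j y) \<in> matrix_algebra" for i
    by (intro matrix_algebra_mult Am_in_matrix_algebra)
  have "br (\<lambda>y. 1 / (t $ j - t $ i) * trace (Am i y ** Am j y)) g x
      = 1 / (t $ j - t $ i) * (trace (Am i x ** entrywise_bracket (Am j) g x)
           + trace (Am j x ** entrywise_bracket (Am i) g x))" for i
    by (simp only: br_scale[OF trace_closed[OF prod] g x] br_trace[OF prod g x]
        entrywise_bracket_mult[OF Am_in_matrix_algebra Am_in_matrix_algebra g x] trace_add
        trace_mul_sym[of "entrywise_bracket (Am i) g x"])
  moreover have "br (\<lambda>y. \<Sum>i\<in>UNIV - {j}. 1 / (t $ j - t $ i) * trace (Am i y ** Am j y)) g x
      = (\<Sum>i\<in>UNIV - {j}. br (\<lambda>y. 1 / (t $ j - t $ i) * trace (Am i y ** Am j y)) g x)"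
    by (intro br_sum g x mult_closed const_closed trace_closed prod) simp
  ultimately show ?thesis
    by (simp add: schlesinger_hamiltonian_def[abs_def])
qed

text \<open>Every term of the Hamiltonian with index \<open>j\<close> contains \<open>A\<^sub>j\<close>, so for \<open>k = j\<close> all of them
  contribute. For \<open>k \<noteq> j\<close> only the term that contains \<open>A\<^sub>k\<close> does.\<close>

lemma br_schlesinger_hamiltonian_Gm:
  assumes x: "x \<in> phase_space"
  shows "br (schlesinger_hamiltonian t j) (\<lambda>y. Gm k y $ c $ d) x
     = Gm k (schlesinger_field t j x) $ c $ d"
proof (cases "j = k")
  case True
  have "br (schlesinger_hamiltonian t j) (\<lambda>y. Gm k y $ c $ d) x
      = (\<Sum>i\<in>UNIV - {k}. 1 / (t $ k - t $ i) * (Am i x ** Gm k x) $ c $ d)"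
    unfolding br_schlesinger_hamiltonian[OF Gm_entry_holomorphic x] True
    by (intro sum.cong refl)
       (auto simp: trace_entrywise_bracket_Am_Gm[OF x trace_Am[OF x]])
  also have "\<dots> = - (\<Sum>i\<in>UNIV - {k}. 1 / (t $ i - t $ k) * (Am i x ** Gm k x) $ c $ d)"
    unfolding sum_negf[symmetric]
    by (intro sum.cong refl) (metis minus_diff_eq minus_divide_right mult_minus_left)
  finally show ?thesis
    using True by (simp add: schlesinger_field_def Gm_def cscale_def)
next
  case False
  have "br (schlesinger_hamiltonian t j) (\<lambda>y. Gm k y $ c $ d) x
      = (\<Sum>i\<in>UNIV - {j}. if i = k then 1 / (t $ j - t $ i) * (Am j x ** Gm k x) $ c $ d else 0)"
    unfolding br_schlesinger_hamiltonian[OF Gm_entry_holomorphic x]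
    using False by (intro sum.cong refl)
       (auto simp: trace_entrywise_bracket_Am_Gm[OF x trace_Am[OF x]])
  then show ?thesis
    using False by (simp add: schlesinger_field_def Gm_def cscale_def)
qed

lemma br_schlesinger_hamiltonian_Lm:
  assumes x: "x \<in> phase_space"
  shows "br (schlesinger_hamiltonian t j) (\<lambda>y. Lm k y $ c $ d) x = 0"
  unfolding br_schlesinger_hamiltonian[OF Lm_entry_holomorphic x]
  by (simp add: entrywise_bracket_Am_Lm[OF x] trace_def)

lemma schlesinger_field_hamiltonian:
  assumes x: "x \<in> phase_space"
  shows "schlesinger_field t j x = hamiltonian_field br schlesinger_hamiltonian t j x"
proof -
  have "fst (schlesinger_field t j x $ k) = matrix_bracket br (schlesinger_hamiltonian t j) (Gm k) x"
    for k
    by (simp add: matrix_bracket_def vec_eq_iff br_schlesinger_hamiltonian_Gm[OF x])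
       (simp add: Gm_def)
  moreover have "snd (schlesinger_field t j x $ k)
      = matrix_bracket br (schlesinger_hamiltonian t j) (Lm k) x" for k
    by (simp add: matrix_bracket_def vec_eq_iff br_schlesinger_hamiltonian_Lm[OF x]
        schlesinger_field_def)
  ultimately show ?thesis
    by (simp add: hamiltonian_field_def vec_eq_iff prod_eq_iff)
qed

end

theorem theorem3:
  fixes br :: "(('n::{finite,linorder}, 'm::finite) ambient \<Rightarrow> complex)
      \<Rightarrow> (('n, 'm) ambient \<Rightarrow> complex) \<Rightarrow> ('n, 'm) ambient \<Rightarrow> complex"
  assumes "is_phase_poisson br"
  shows "(\<forall>t\<in>distinct_times. \<forall>j. \<forall>x\<in>phase_space.
           schlesinger_field t j x = hamiltonian_field br schlesinger_hamiltonian t j x) \<and>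
         (\<forall>T \<gamma>. open T \<and> T \<subseteq> distinct_times \<longrightarrow>
           (solves_on schlesinger_field T \<gamma> \<longleftrightarrow>
            solves_on (hamiltonian_field br schlesinger_hamiltonian) T \<gamma>))"
proof -
  interpret phase_poisson br
    using assms by unfold_locales
  have eq: "schlesinger_field t j x = hamiltonian_field br schlesinger_hamiltonian t j x"
    if "x \<in> phase_space" for t j x
    using that by (rule schlesinger_field_hamiltonian)
  have "solves_on schlesinger_field T \<gamma> \<longleftrightarrow>
      solves_on (hamiltonian_field br schlesinger_hamiltonian) T \<gamma>" for T \<gamma>
    unfolding solves_on_def by (intro ball_cong refl conj_cong) (simp add: eq)
  then show ?thesis
    using eq by blast
qed

end
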